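(* Let $\mathcal{K}$ be a Mercer kernel on a set of objects $\mathcal{X}$ with induced metric $d_\mathcal{K}$, let $S\subseteq\mathcal{X}$ be finite, let $T$ be a cover tree on $S$ with respect to $d_\mathcal{K}$, let $q\in\mathcal{X}$ and let $\epsilon>0$. Run the algorithm FastMKS$(T,q)$ with the absolute value approximation (AVA) stopping rule: at the end of the iteration at level $i$, if $\epsilon\ge 2^i\sqrt{\mathcal{K}(q,q)}$, stop and return the best candidate found so far, $p\in\arg\max_{r\in R_{i-1}}\mathcal{K}(q,r)$. Then the returned point $p\in S$ satisfies $\mathcal{K}(q,p)\ge\max_{r\in S}\mathcal{K}(q,r)-\epsilon$.
   Context: $\mathcal{K}(x,y)=\langle\varphi(x),\varphi(y)\rangle_{\mathcal{H}}$ for a feature map $\varphi$ into a Hilbert space $\mathcal{H}$, and $d_\mathcal{K}(x,y)=\sqrt{\mathcal{K}(x,x)+\mathcal{K}(y,y)-2\mathcal{K}(x,y)}$. A cover tree on a finite set $S$ with respect to a metric $d$ is a leveled tree with levels $C_i\subseteq S$ indexed by integers $i$ (decreasing as the tree is descended), where $C_\infty$ is a single point (the root) and $C_{-\infty}=S$, satisfying for all $i$: (nesting) $C_i\subseteq C_{i-1}$; (covering) for every $p\in C_{i-1}$ there is $q\in C_i$ with $d(p,q)\le 2^i$, and exactly one such $q$ is the parent of $p$; (separation) for all distinct $p,q\in C_i$, $d(p,q)>2^i$. The children of $r\in C_i$ are the points of $C_{i-1}$ whose parent is $r$ (including $r$). For finite $R$, $\mathcal{K}(q,R)=\max_{r\in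 R}\mathcal{K}(q,r)$. FastMKS$(T,q)$: set $R_\infty=C_\infty$; for $i$ from $\infty$ down to $-\infty$, let $R=\{\text{children of } r: r\in R_i\}$ and $R_{i-1}=\{r\in R:\mathcal{K}(q,r)\ge\mathcal{K}(q,R)-2^i\sqrt{\mathcal{K}(q,q)}\}$; (without stopping) return $\arg\max_{r\in R_{-\infty}}\mathcal{K}(q,r)$. *)

theory Defs
  imports "HOL-Analysis.Inner_Product"
begin

definition mercer_kernel_on ::
  "'x set \<Rightarrow> ('x \<Rightarrow> 'x \<Rightarrow> real) \<Rightarrow> ('x \<Rightarrow> 'h::{real_inner,complete_space}) \<Rightarrow> bool" where
  "mercer_kernel_on X K \<phi> \<longleftrightarrow> (\<forall>x\<in>X. \<forall>y\<in>X. K x y = inner (\<phi> x) (\<phi> y))"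

definition kernel_dist :: "('x \<Rightarrow> 'x \<Rightarrow> real) \<Rightarrow> 'x \<Rightarrow> 'x \<Rightarrow> real" where
  "kernel_dist K x y = sqrt (K x x + K y y - 2 * K x y)"

(* The formal levels C_\<infinity> = {rt} and C_{-\<infinity>} = S are the eventual values of C;
   as S is finite and the levels are nested, these are their limits.
   parent i p is the parent, in level i, of the point p of level i - 1. *)
definition cover_tree ::
  "('x \<Rightarrow> 'x \<Rightarrow> real) \<Rightarrow> 'x set \<Rightarrow> 'x \<Rightarrow> (int \<Rightarrow> 'x set) \<Rightarrow> (int \<Rightarrow> 'x \<Rightarrow> 'x) \<Rightarrow> bool" where
  "cover_tree d S rt C parent \<longleftrightarrow>
     (\<forall>\<^sub>F i in at_top. C i = {rt}) \<and>
     (\<forall>\<^sub>F i in at_bot. C i = S) \<and>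
     (\<forall>i. C i \<subseteq> S) \<and>
     (\<forall>i. C i \<subseteq> C (i - 1)) \<and>
     (\<forall>i. \<forall>p\<in>C (i - 1). parent i p \<in> C i \<and> d p (parent i p) \<le> 2 powi i) \<and>
     (\<forall>i. \<forall>p\<in>C i. \<forall>q\<in>C i. p \<noteq> q \<longrightarrow> d p q > 2 powi i)"

definition children ::
  "(int \<Rightarrow> 'x set) \<Rightarrow> (int \<Rightarrow> 'x \<Rightarrow> 'x) \<Rightarrow> int \<Rightarrow> 'x \<Rightarrow> 'x set" where
  "children C parent i r = {p \<in> C (i - 1). parent i p = r}"

(* Covering and separation force every point of C i to be its own parent. *)
lemma self_in_children:
  assumes "cover_tree d S rt C parent" and "r \<in> C i"
  shows "r \<in> children C parent i r"
proof -
  have 1: "r \<in> C (i - 1)"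
    using assms unfolding cover_tree_def by blast
  then have "parent i r \<in> C i" "d r (parent i r) \<le> 2 powi i"
    using assms(1) unfolding cover_tree_def by blast+
  moreover have "r \<noteq> parent i r \<Longrightarrow> parent i r \<in> C i \<Longrightarrow> d r (parent i r) > 2 powi i"
    using assms unfolding cover_tree_def by blast
  ultimately show ?thesis
    using 1 unfolding children_def by force
qed

(* The iteration at level i, taking R_i to R_{i-1}. *)
definition fastmks_step ::
  "('x \<Rightarrow> 'x \<Rightarrow> real) \<Rightarrow> (int \<Rightarrow> 'x set) \<Rightarrow> (int \<Rightarrow> 'x \<Rightarrow> 'x) \<Rightarrow> 'x \<Rightarrow> int \<Rightarrow> 'x set \<Rightarrow> 'x set" where
  "fastmks_step K C parent q i Ri =
     (let R = (\<Union>r\<in>Ri. children C parent i r)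
      in {r \<in> R. K q r \<ge> (MAX r'\<in>R. K q r') - 2 powi i * sqrt (K q q)})"

(* fastmks_ava_loop K C parent q \<epsilon> i R p: the loop entered at level i with R_i = R
   stops and may return p (a relation, since the maximiser need not be unique). *)
inductive fastmks_ava_loop ::
  "('x \<Rightarrow> 'x \<Rightarrow> real) \<Rightarrow> (int \<Rightarrow> 'x set) \<Rightarrow> (int \<Rightarrow> 'x \<Rightarrow> 'x) \<Rightarrow> 'x \<Rightarrow> real \<Rightarrow> int \<Rightarrow> 'x set \<Rightarrow> 'x \<Rightarrow> bool"
  for K C parent q \<epsilon> where
  stop: "\<epsilon> \<ge> 2 powi i * sqrt (K q q) \<Longrightarrow>
         is_arg_max (K q) (\<lambda>r. r \<in> fastmks_step K C parent q i R) p \<Longrightarrow>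
         fastmks_ava_loop K C parent q \<epsilon> i R p"
| continue: "\<not> \<epsilon> \<ge> 2 powi i * sqrt (K q q) \<Longrightarrow>
         fastmks_ava_loop K C parent q \<epsilon> (i - 1) (fastmks_step K C parent q i R) p \<Longrightarrow>
         fastmks_ava_loop K C parent q \<epsilon> i R p"

(* Starting at level \<infinity> with R_\<infinity> = {rt} means starting at any sufficiently high level:
   where C i = C (i - 1) = {rt}, an iteration maps {rt} to itself, so the results of
   the loop do not depend on the starting level once it is high enough (if K q q = 0, the
   loop stops in its first iteration and returns the root). *)
definition fastmks_ava_returns ::
  "('x \<Rightarrow> 'x \<Rightarrow> real) \<Rightarrow> 'x \<Rightarrow> (int \<Rightarrow> 'x set) \<Rightarrow> (int \<Rightarrow> 'x \<Rightarrow> 'x) \<Rightarrow> 'x \<Rightarrow> real \<Rightarrow> 'x \<Rightarrow> bool" where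
  "fastmks_ava_returns K rt C parent q \<epsilon> p \<longleftrightarrow>
     (\<forall>\<^sub>F i in at_top. fastmks_ava_loop K C parent q \<epsilon> i {rt} p)"

end

theory Submission
  imports Defs
begin

text \<open>
  Fix a maximiser \<open>s\<close> of \<open>K q\<close> over \<open>S\<close> and let \<open>a i \<in> C i\<close> be its ancestors.  Summing the covering
  radii along the branch gives \<open>d s (a (i - 1)) \<le> 2 powi i\<close>, so by Cauchy--Schwarz \<open>K q (a (i - 1))\<close> is
  within \<open>2 powi i * sqrt (K q q)\<close> of the maximum.  Hence pruning never discards the current ancestor
  of \<open>s\<close>, and when the loop stops at level \<open>i\<close> that ancestor is a candidate whose value is
  within \<open>\<epsilon>\<close> of the optimum.
\<close>

lemma ex_is_arg_max_if_finite:
  fixes f :: "'a \<Rightarrow> 'b::linorder"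
  assumes "finite A" "A \<noteq> {}"
  shows "\<exists>x. is_arg_max f (\<lambda>x. x \<in> A) x"
proof -
  have "Max (f ` A) \<in> f ` A"
    using assms by (intro Max_in) auto
  then obtain x where x: "x \<in> A" "f x = Max (f ` A)"
    by auto
  then have "f y \<le> f x" if "y \<in> A" for y
    using assms(1) that by simp
  with x(1) show ?thesis
    by (auto simp: is_arg_max_linorder)
qed

locale kernel_cover_tree =
  fixes X S :: "'x set"
    and K :: "'x \<Rightarrow> 'x \<Rightarrow> real"
    and \<phi> :: "'x \<Rightarrow> 'h::{real_inner,complete_space}"
    and rt q :: 'x
    and C :: "int \<Rightarrow> 'x set"
    and parent :: "int \<Rightarrow> 'x \<Rightarrow> 'x"
  assumes mercer: "mercer_kernel_on X K \<phi>"
    and finite_S: "finite S"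
    and S_subset: "S \<subseteq> X"
    and tree: "cover_tree (kernel_dist K) S rt C parent"
    and q_in: "q \<in> X"
begin

section \<open>The kernel as an inner product in feature space\<close>

lemma kernel_eq_inner: "x \<in> X \<Longrightarrow> y \<in> X \<Longrightarrow> K x y = inner (\<phi> x) (\<phi> y)"
  using mercer unfolding mercer_kernel_on_def by blast

lemma sqrt_kernel_diag: "sqrt (K q q) = norm (\<phi> q)"
  using kernel_eq_inner[OF q_in q_in] by (simp add: norm_eq_sqrt_inner)

lemma kernel_dist_eq_norm:
  assumes "x \<in> X" "y \<in> X"
  shows "kernel_dist K x y = norm (\<phi> x - \<phi> y)"
  using assms
  by (simp add: kernel_dist_def kernel_eq_inner norm_eq_sqrt_inner algebra_simps inner_commute)

text \<open>\<open>K q\<close> is a linear functional of the feature vector, so Cauchy--Schwarz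
  makes it Lipschitz with constant \<open>sqrt (K q q)\<close>. This turns tree distances into
  kernel slack.\<close>

lemma kernel_diff_le:
  assumes "x \<in> X" "y \<in> X"
  shows "K q x \<le> K q y + norm (\<phi> x - \<phi> y) * sqrt (K q q)"
proof -
  have "K q x - K q y = inner (\<phi> q) (\<phi> x - \<phi> y)"
    using assms q_in by (simp add: kernel_eq_inner inner_diff_right)
  also have "\<dots> \<le> norm (\<phi> q) * norm (\<phi> x - \<phi> y)"
    by (rule norm_cauchy_schwarz)
  finally show ?thesis
    by (simp add: sqrt_kernel_diag mult.commute)
qed

section \<open>Levels and parents of the cover tree\<close>

lemma level_subset: "C i \<subseteq> S"
  using tree unfolding cover_tree_def by blast

lemma parent_in_level: "p \<in> C (i - 1) \<Longrightarrow> parent i p \<in> C i"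
  using tree unfolding cover_tree_def by blast

lemma norm_parent_le:
  assumes "p \<in> C (i - 1)"
  shows "norm (\<phi> p - \<phi> (parent i p)) \<le> 2 powi i"
proof -
  have "kernel_dist K p (parent i p) \<le> 2 powi i"
    using tree assms unfolding cover_tree_def by blast
  moreover have "p \<in> X" "parent i p \<in> X"
    using assms parent_in_level level_subset S_subset by blast+
  ultimately show ?thesis
    by (simp add: kernel_dist_eq_norm)
qed

lemma parent_self: "p \<in> C i \<Longrightarrow> parent i p = p"
  using self_in_children[OF tree] by (simp add: children_def)

lemma root_in_S: "rt \<in> S"
proof -
  obtain i where "C i = {rt}"
    using tree unfolding cover_tree_def by (auto simp: eventually_at_top_linorder)
  then show ?thesis
    using level_subset[of i] by simp
qed

section \<open>Ancestor branches\<close>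

text \<open>The radius \<open>2 powi (i + 1)\<close> bounds the geometric sum of the covering radii
  at levels up to \<open>i\<close>. The parent equation makes \<open>a (i - 1)\<close> a child of
  \<open>a i\<close>, as one loop iteration requires.\<close>

definition branch :: "'x \<Rightarrow> (int \<Rightarrow> 'x) \<Rightarrow> bool" where
  "branch s a \<longleftrightarrow> (\<forall>i. a i \<in> C i \<and> parent i (a (i - 1)) = a i \<and>
                       norm (\<phi> s - \<phi> (a i)) \<le> 2 powi (i + 1))"

lemma exists_branch:
  assumes "s \<in> S"
  obtains a where "branch s a"
proof -
  obtain N where N: "\<And>i. i \<le> N \<Longrightarrow> C i = S"
    using tree unfolding cover_tree_def eventually_at_bot_linorder by blast
  \<comment> \<open>\<open>b n\<close> is the ancestor of \<open>s\<close> at level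
    \<open>N + n\<close>, reached by climbing from a level that is all of \<open>S\<close>.\<close>
  define b where "b = rec_nat s (\<lambda>n. parent (N + int (Suc n)))"
  have b_0: "b 0 = s" and b_Suc: "b (Suc n) = parent (N + int (Suc n)) (b n)" for n
    by (simp_all add: b_def)
  have b: "b n \<in> C (N + int n) \<and> norm (\<phi> s - \<phi> (b n)) \<le> 2 powi (N + int n + 1)" for n
  proof (induction n)
    case 0
    then show ?case using N[of N] assms by (simp add: b_0)
  next
    case (Suc n)
    let ?i = "N + int (Suc n)"
    have mem: "b n \<in> C (?i - 1)" and le: "norm (\<phi> s - \<phi> (b n)) \<le> 2 powi ?i"
      using Suc by (simp_all add: algebra_simps)
    have "norm (\<phi> s - \<phi> (b (Suc n)))
            \<le> norm (\<phi> s - \<phi> (b n)) + norm (\<phi> (b n) - \<phi> (b (Suc n)))"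
      by (rule norm_diff_triangle_le) auto
    also have "\<dots> \<le> 2 powi ?i + 2 powi ?i"
      using le norm_parent_le[OF mem] unfolding b_Suc by (rule add_mono)
    also have "\<dots> = 2 powi (?i + 1)"
      using power_int_add_1[of "2::real" ?i] by simp
    finally show ?case
      using parent_in_level[OF mem] by (simp add: b_Suc)
  qed
  \<comment> \<open>\<open>nat\<close> truncates at 0, so up to level \<open>N\<close> the branch
    stays at \<open>s\<close>, which is its own parent there.\<close>
  define a where "a i = b (nat (i - N))" for i
  have "a i \<in> C i \<and> parent i (a (i - 1)) = a i \<and> norm (\<phi> s - \<phi> (a i)) \<le> 2 powi (i + 1)" for i
  proof (cases "i \<le> N")
    case True
    then have "a i = s" "a (i - 1) = s" "C i = S"
      by (simp_all add: a_def b_0 N)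
    then show ?thesis
      using assms parent_self[of s i] by simp
  next
    case False
    define n where "n = nat (i - N - 1)"
    have i: "i = N + int (Suc n)"
      using False by (simp add: n_def)
    have "a i = b (Suc n)" "a (i - 1) = b n"
      unfolding a_def i by (simp_all add: nat_add_distrib)
    then show ?thesis
      using b[of "Suc n"] b_Suc[of n] unfolding i by simp
  qed
  then show ?thesis
    using that unfolding branch_def by blast
qed

section \<open>Pruning and the error bound\<close>

lemma fastmks_step_subset: "fastmks_step K C parent q i R \<subseteq> C (i - 1)"
  by (auto simp: fastmks_step_def children_def Let_def)

text \<open>The index shift matters: the radius at level \<open>i - 1\<close> is
  \<open>2 powi i\<close>, exactly the slack of the pruning and stopping tests at level
  \<open>i\<close>.\<close>

lemma branch_kernel_le:
  assumes "s \<in> S" "branch s a"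
  shows "K q s \<le> K q (a (i - 1)) + 2 powi i * sqrt (K q q)"
proof -
  have a: "a (i - 1) \<in> C (i - 1)" "norm (\<phi> s - \<phi> (a (i - 1))) \<le> 2 powi (i - 1 + 1)"
    using assms(2) unfolding branch_def by blast+
  have "K q s \<le> K q (a (i - 1)) + norm (\<phi> s - \<phi> (a (i - 1))) * sqrt (K q q)"
    using assms(1) a(1) level_subset S_subset by (intro kernel_diff_le) blast+
  also have "\<dots> \<le> K q (a (i - 1)) + 2 powi i * sqrt (K q q)"
    using a(2) by (intro add_left_mono mult_right_mono) (simp_all add: sqrt_kernel_diag)
  finally show ?thesis .
qed

text \<open>All candidates lie in \<open>S\<close>, so their maximum is at most
  \<open>K q s\<close>; the pruning threshold is then no higher than the value guaranteed for
  \<open>a (i - 1)\<close>.\<close>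

lemma branch_in_fastmks_step:
  assumes "is_arg_max (K q) (\<lambda>r. r \<in> S) s" "branch s a" "a i \<in> R"
  shows "a (i - 1) \<in> fastmks_step K C parent q i R"
proof -
  let ?R = "\<Union>r\<in>R. children C parent i r"
  have s: "s \<in> S" "\<And>r. r \<in> S \<Longrightarrow> K q r \<le> K q s"
    using assms(1) by (auto simp: is_arg_max_linorder)
  have a: "a (i - 1) \<in> ?R"
    using assms(2,3) unfolding branch_def children_def by blast
  have "?R \<subseteq> S"
    using level_subset by (auto simp: children_def)
  then have "(MAX r\<in>?R. K q r) \<le> K q s"
    using a finite_S s(2) by (subst Max_le_iff) (auto dest: finite_subset)
  then show ?thesis
    using a branch_kernel_le[OF s(1) assms(2), of i] unfolding fastmks_step_def Let_def by auto
qed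

text \<open>Rule induction on the loop with the invariant \<open>a i \<in> R\<close>.\<close>

lemma fastmks_ava_loop_approx:
  assumes "is_arg_max (K q) (\<lambda>r. r \<in> S) s" "branch s a"
    and "fastmks_ava_loop K C parent q \<epsilon> i R p" "a i \<in> R"
  shows "p \<in> S \<and> K q s - \<epsilon> \<le> K q p"
  using assms(3,4)
proof (induction rule: fastmks_ava_loop.induct)
  case (stop i R p)
  have "a (i - 1) \<in> fastmks_step K C parent q i R"
    using assms(1,2) stop.prems by (rule branch_in_fastmks_step)
  then have "K q (a (i - 1)) \<le> K q p" "p \<in> fastmks_step K C parent q i R"
    using stop.hyps(2) by (auto simp: is_arg_max_linorder)
  moreover have "K q s \<le> K q (a (i - 1)) + 2 powi i * sqrt (K q q)"
    using assms(1,2) by (intro branch_kernel_le) (auto simp: is_arg_max_linorder)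
  ultimately show ?case
    using stop.hyps(1) fastmks_step_subset level_subset by fastforce
next
  case (continue i R p)
  then show ?case
    using branch_in_fastmks_step[OF assms(1,2)] by blast
qed

section \<open>Termination\<close>

text \<open>The slack halves with each level, so the stopping test eventually succeeds; the
  surviving ancestor keeps the candidate set nonempty, so a maximiser exists.\<close>

lemma exists_fastmks_ava_loop:
  assumes "is_arg_max (K q) (\<lambda>r. r \<in> S) s" "branch s a" "a i \<in> R" "\<epsilon> > 0"
  shows "\<exists>p. fastmks_ava_loop K C parent q \<epsilon> i R p"
proof -
  have stop_returns: "\<exists>p. fastmks_ava_loop K C parent q \<epsilon> i R p"
    if "2 powi i * sqrt (K q q) \<le> \<epsilon>" "a i \<in> R" for i R
  proof -
    let ?R = "fastmks_step K C parent q i R"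
    have "?R \<subseteq> S"
      using fastmks_step_subset level_subset by (rule subset_trans)
    then have "finite ?R"
      using finite_S by (rule finite_subset)
    moreover have "?R \<noteq> {}"
      using branch_in_fastmks_step[OF assms(1,2) that(2)] by blast
    ultimately have "\<exists>p. is_arg_max (K q) (\<lambda>r. r \<in> ?R) p"
      using ex_is_arg_max_if_finite by blast
    then show ?thesis
      using that(1) by (blast intro: fastmks_ava_loop.stop)
  qed
  \<comment> \<open>\<open>n\<close> only bounds the number of further levels: the test may already
    succeed earlier, in which case \<open>stop_returns\<close> applies.\<close>
  have returns: "\<exists>p. fastmks_ava_loop K C parent q \<epsilon> i R p"
    if "2 powi (i - int n) * sqrt (K q q) \<le> \<epsilon>" "a i \<in> R" for n i R
    using that
  proof (induction n arbitrary: i R)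
    case 0
    then show ?case using stop_returns by simp
  next
    case (Suc n)
    have "a (i - 1) \<in> fastmks_step K C parent q i R"
      using assms(1,2) Suc.prems(2) by (rule branch_in_fastmks_step)
    moreover have "2 powi (i - 1 - int n) * sqrt (K q q) \<le> \<epsilon>"
      using Suc.prems(1) by (simp add: algebra_simps)
    ultimately have "\<exists>p. fastmks_ava_loop K C parent q \<epsilon> (i - 1) (fastmks_step K C parent q i R) p"
      by (intro Suc.IH)
    then show ?case
      using stop_returns[OF _ Suc.prems(2)] by (blast intro: fastmks_ava_loop.continue)
  qed
  obtain n where n: "2 powi i * sqrt (K q q) / \<epsilon> < 2 ^ n"
    using real_arch_pow[of 2] by auto
  have "2 powi (i - int n) * sqrt (K q q) \<le> \<epsilon>"
    using n assms(4) by (simp add: power_int_diff field_simps)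
  then show ?thesis
    using assms(3) by (rule returns)
qed

section \<open>Starting from sufficiently high levels\<close>

lemma fastmks_step_root:
  assumes "C i = {rt}" "C (i - 1) = {rt}"
  shows "fastmks_step K C parent q i {rt} = {rt}"
proof -
  have "children C parent i rt = {rt}"
    using assms parent_self[of rt i] by (auto simp: children_def)
  \<comment> \<open>Writing \<open>sqrt (K q q)\<close> as a norm shows that the slack is
    nonnegative, so the root passes its own test.\<close>
  then show ?thesis
    by (auto simp: fastmks_step_def sqrt_kernel_diag)
qed

text \<open>
  A loop that stops at level \<open>i + 1\<close> would also have stopped at level \<open>i\<close>, where it returned the root.
\<close>
lemma fastmks_ava_loop_root_Suc:
  assumes "C (i + 1) = {rt}" "C i = {rt}" "C (i - 1) = {rt}"
    and "fastmks_ava_loop K C parent q \<epsilon> i {rt} p"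
  shows "fastmks_ava_loop K C parent q \<epsilon> (i + 1) {rt} p"
proof (cases "2 powi (i + 1) * sqrt (K q q) \<le> \<epsilon>")
  case True
  have "2 powi i * sqrt (K q q) \<le> 2 powi (i + 1) * sqrt (K q q)"
    by (intro mult_right_mono power_int_increasing) (simp_all add: sqrt_kernel_diag)
  with True have "2 powi i * sqrt (K q q) \<le> \<epsilon>"
    by linarith
  with assms(4) have "p = rt"
    by (cases rule: fastmks_ava_loop.cases)
      (simp_all add: fastmks_step_root[OF assms(2,3)] is_arg_max_def)
  then show ?thesis
    using True fastmks_step_root[of "i + 1"] assms(1,2)
    by (intro fastmks_ava_loop.stop) (auto simp: is_arg_max_def)
next
  case False
  then show ?thesis
    using fastmks_step_root[of "i + 1"] assms by (simp add: fastmks_ava_loop.continue)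
qed

lemma exists_fastmks_ava_returns:
  assumes "\<epsilon> > 0" "is_arg_max (K q) (\<lambda>r. r \<in> S) s" "branch s a"
  shows "\<exists>p. fastmks_ava_returns K rt C parent q \<epsilon> p"
proof -
  obtain N where N: "\<And>i. i \<ge> N \<Longrightarrow> C i = {rt}"
    using tree unfolding cover_tree_def eventually_at_top_linorder by blast
  have "a (N + 1) \<in> {rt}"
    using assms(3) N[of "N + 1"] unfolding branch_def by auto
  \<comment> \<open>The start is \<open>N + 1\<close> rather than \<open>N\<close> because lifting a
    result from level \<open>i\<close> to \<open>i + 1\<close> also needs
    \<open>C (i - 1) = {rt}\<close>.\<close>
  then obtain p where p: "fastmks_ava_loop K C parent q \<epsilon> (N + 1) {rt} p"
    using exists_fastmks_ava_loop[OF assms(2,3)] assms(1) by blast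
  have "fastmks_ava_loop K C parent q \<epsilon> i {rt} p" if "i \<ge> N + 1" for i
    using that
  proof (induction i rule: int_ge_induct)
    case base
    show ?case by (rule p)
  next
    case (step i)
    then show ?case by (intro fastmks_ava_loop_root_Suc N) auto
  qed
  then show ?thesis
    unfolding fastmks_ava_returns_def eventually_at_top_linorder by blast
qed

text \<open>It suffices to pick one starting level with \<open>C i = {rt}\<close>: there the
  ancestor of \<open>s\<close> is the root, so the loop invariant holds initially.\<close>

lemma fastmks_ava_returns_approx:
  assumes "is_arg_max (K q) (\<lambda>r. r \<in> S) s" "branch s a" "fastmks_ava_returns K rt C parent q \<epsilon> p"
  shows "p \<in> S \<and> K q s - \<epsilon> \<le> K q p"
proof -
  have "\<forall>\<^sub>F i in at_top. C i = {rt} \<and> fastmks_ava_loop K C parent q \<epsilon> i {rt} p"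
    using assms(3) tree unfolding fastmks_ava_returns_def cover_tree_def
    by (intro eventually_conj) auto
  then obtain i where i: "C i = {rt}" "fastmks_ava_loop K C parent q \<epsilon> i {rt} p"
    unfolding eventually_at_top_linorder by blast
  moreover have "a i \<in> {rt}"
    using assms(2) i(1) unfolding branch_def by auto
  ultimately show ?thesis
    using fastmks_ava_loop_approx[OF assms(1,2)] by blast
qed

end

theorem theorem4p4:
  fixes X S :: "'x set"
    and K :: "'x \<Rightarrow> 'x \<Rightarrow> real"
    and \<phi> :: "'x \<Rightarrow> 'h::{real_inner,complete_space}"
    and rt q :: 'x
    and C :: "int \<Rightarrow> 'x set"
    and parent :: "int \<Rightarrow> 'x \<Rightarrow> 'x"
    and \<epsilon> :: real
  assumes "mercer_kernel_on X K \<phi>"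
    and "finite S" and "S \<subseteq> X"
    and "cover_tree (kernel_dist K) S rt C parent"
    and "q \<in> X"
    and "\<epsilon> > 0"
  shows "(\<exists>p. fastmks_ava_returns K rt C parent q \<epsilon> p) \<and>
         (\<forall>p. fastmks_ava_returns K rt C parent q \<epsilon> p \<longrightarrow>
              p \<in> S \<and> K q p \<ge> (MAX r\<in>S. K q r) - \<epsilon>)"
proof -
  interpret kernel_cover_tree X S K \<phi> rt q C parent
    using assms(1-5) by unfold_locales
  \<comment> \<open>The root witnesses that \<open>S\<close> is nonempty.\<close>
  obtain s where s: "is_arg_max (K q) (\<lambda>r. r \<in> S) s"
    using ex_is_arg_max_if_finite[OF assms(2)] root_in_S by blast
  then have "s \<in> S"
    by (simp add: is_arg_max_linorder)
  then obtain a where a: "branch s a"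
    by (rule exists_branch)
  have "(MAX r\<in>S. K q r) = K q s"
    using s assms(2) by (intro Max_eqI) (auto simp: is_arg_max_linorder)
  then show ?thesis
    using exists_fastmks_ava_returns[OF assms(6) s a] fastmks_ava_returns_approx[OF s a] by simp
qed

end
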